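(* Let $A\in\mathbb{R}^{m\times n}$ have only finite entries, let $b\in\mathbb{R}^m$, and let $E$ be the $\ell_1$-error set function associated with $(A,b)$. Suppose $\epsilon\ge 0$ is such that $E(J)\le\epsilon$ and $E(\emptyset)>\epsilon$. Let $k$ be the time at which the greedy algorithm (described in the context), run on input $(A,b)$ with tolerance $\epsilon$, terminates, and let $\hat x$, $T_k$ be its outputs. Then $\hat x$ is a suboptimal solution (a feasible point, not necessarily optimal) of the problem $$(Q)\qquad \text{minimize } |\operatorname{supp}(x)| \text{ over } x\in\mathbb{R}_{\max}^n \text{ subject to } \|b-A\boxplus x\|_1\le\epsilon,\ \ A\boxplus x\le b,$$ with $T_k=\operatorname{supp}(\hat x)$. Moreover, if $T^*=\operatorname{supp}(x^* )$, where $x^*$ is an optimal solution of $(Q)$, then $$\frac{|T_k|}{|T^*|}\le 1+\log\left(\frac{m\Delta}{E(T_{k-1})-\epsilon}\right),\qquad \text{where } \Delta=\max_{i\in I,\,j\in J}\,(b_i-A_{ij}-\bar x_j)$$ and $\bar x_j=\min_{i\in I}(b_i-A_{ij})$.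
   Context: $I=\{1,\dots,m\}$, $J=\{1,\dots,n\}$. $\mathbb{R}_{\max}=\mathbb{R}\cup\{-\infty\}$ with $a+(-\infty)=-\infty$ and $b_i-(-\infty)=+\infty$. For $x\in\mathbb{R}_{\max}^n$: $[A\boxplus x]_i=\max_{j\in J}(A_{ij}+x_j)$; $\operatorname{supp}(x)=\{j\in J:x_j\ne-\infty\}$; vector inequalities are componentwise; the $\ell_1$-norm is $+\infty$ if some component is infinite. $\log$ is the natural logarithm. The vector $\bar x$ is the principal solution. Let $A_j$ be the $j$-th column of $A$, $A_j+\bar x_j$ the vector with components $A_{ij}+\bar x_j$, and $\bigvee$ the componentwise maximum. Define for $T\subseteq J$ $$e(T)=b-\bigvee_{j\in T}(A_j+\bar x_j)\ (T\ne\emptyset),\qquad e(\emptyset)=\bigvee_{j\in J}e(\{j\}),\qquad E(T)=\|e(T)\|_1 .$$ Greedy algorithm on input $(A,b)$ with tolerance $\epsilon$: compute $\bar x$; if $E(J)>\epsilon$ return "infeasible". Otherwise set $\hat x_j=-\infty$ for all $j\in J$, $T_0=\emptyset$, $k=0$. While $E(T_k)>\epsilon$: increase $k$ by one, choose $j\in\arg\min_{s\in J\setminus T_{k-1}}E(T_{k-1}\cup\{s\})$ (ties broken arbitrarily), and set $T_k=T_{k-1}\cup\{j\}$. When the loop stops, set $\hat x_j=\bar x_j$ for $j\in T_k$ and return $\hat x$, $T_k$. *)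

theory Defs
  imports "HOL-Analysis.Analysis"
begin

text \<open>
  The index sets I and J are the finite types \<open>'m\<close> and \<open>'n\<close>.  The semiring of real numbers
  extended by minus infinity is the set of \<open>ereal\<close> values other than \<open>\<infinity>\<close>; on it \<open>ereal\<close>
  arithmetic follows the max-plus conventions (adding \<open>-\<infinity>\<close> to a real gives \<open>-\<infinity>\<close>,
  subtracting \<open>-\<infinity>\<close> from a real gives \<open>\<infinity>\<close>).
\<close>

definition Rmax_vectors :: "(ereal ^ 'n) set" where
  "Rmax_vectors = {x. \<forall>j. x $ j \<noteq> \<infinity>}"

definition maxplus_mult :: "real ^ 'n ^ 'm \<Rightarrow> ereal ^ 'n \<Rightarrow> ereal ^ 'm" (infixr \<open>\<boxplus>\<close> 70) where
  "A \<boxplus> x = (\<chi> i. MAX j. ereal (A $ i $ j) + x $ j)"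

definition supp :: "ereal ^ 'n \<Rightarrow> 'n set" where
  "supp x = {j. x $ j \<noteq> -\<infinity>}"

definition ereal_vec :: "real ^ 'm \<Rightarrow> ereal ^ 'm" where
  "ereal_vec b = (\<chi> i. ereal (b $ i))"

definition l1_norm :: "ereal ^ 'm \<Rightarrow> ereal" where
  "l1_norm v = (\<Sum>i\<in>UNIV. \<bar>v $ i\<bar>)"

definition principal_solution :: "real ^ 'n ^ 'm \<Rightarrow> real ^ 'm \<Rightarrow> real ^ 'n" where
  "principal_solution A b = (\<chi> j. MIN i. b $ i - A $ i $ j)"

definition residual :: "real ^ 'n ^ 'm \<Rightarrow> real ^ 'm \<Rightarrow> 'n set \<Rightarrow> real ^ 'm" where
  "residual A b T = (\<chi> i. b $ i - (MAX j\<in>T. A $ i $ j + principal_solution A b $ j))"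

text \<open>\<open>residual\<close> is meaningful for nonempty sets only.\<close>

definition error_vec :: "real ^ 'n ^ 'm \<Rightarrow> real ^ 'm \<Rightarrow> 'n set \<Rightarrow> real ^ 'm" where
  "error_vec A b T =
     (if T = {} then (\<chi> i. MAX j. residual A b {j} $ i) else residual A b T)"

definition l1_error :: "real ^ 'n ^ 'm \<Rightarrow> real ^ 'm \<Rightarrow> 'n set \<Rightarrow> real" where
  "l1_error A b T = (\<Sum>i\<in>UNIV. \<bar>error_vec A b T $ i\<bar>)"

definition feasible_set :: "real ^ 'n ^ 'm \<Rightarrow> real ^ 'm \<Rightarrow> real \<Rightarrow> (ereal ^ 'n) set" where
  "feasible_set A b \<epsilon> =
     {x \<in> Rmax_vectors. l1_norm (ereal_vec b - A \<boxplus> x) \<le> ereal \<epsilon> \<and> A \<boxplus> x \<le> ereal_vec b}"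

definition optimal_solution :: "real ^ 'n ^ 'm \<Rightarrow> real ^ 'm \<Rightarrow> real \<Rightarrow> ereal ^ 'n \<Rightarrow> bool" where
  "optimal_solution A b \<epsilon> x \<longleftrightarrow>
     x \<in> feasible_set A b \<epsilon> \<and> (\<forall>y \<in> feasible_set A b \<epsilon>. card (supp x) \<le> card (supp y))"

text \<open>
  The algorithm is nondeterministic, as ties are broken arbitrarily, so its executions are described
  by predicates on sequences of sets.  Members of the sequence after the loop has stopped are
  irrelevant and left unconstrained.
\<close>

definition greedy_step :: "real ^ 'n ^ 'm \<Rightarrow> real ^ 'm \<Rightarrow> 'n set \<Rightarrow> 'n set \<Rightarrow> bool" where
  "greedy_step A b S S' \<longleftrightarrow>
     (\<exists>j. is_arg_min (\<lambda>s. l1_error A b (S \<union> {s})) (\<lambda>s. s \<in> - S) j \<and> S' = S \<union> {j})"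

definition greedy_sequence :: "real ^ 'n ^ 'm \<Rightarrow> real ^ 'm \<Rightarrow> real \<Rightarrow> (nat \<Rightarrow> 'n set) \<Rightarrow> bool" where
  "greedy_sequence A b \<epsilon> T \<longleftrightarrow>
     T 0 = {} \<and>
     (\<forall>i. (\<forall>l\<le>i. l1_error A b (T l) > \<epsilon>) \<longrightarrow> greedy_step A b (T i) (T (Suc i)))"

definition greedy_output :: "real ^ 'n ^ 'm \<Rightarrow> real ^ 'm \<Rightarrow> 'n set \<Rightarrow> ereal ^ 'n" where
  "greedy_output A b S = (\<chi> j. if j \<in> S then ereal (principal_solution A b $ j) else -\<infinity>)"

text \<open>
  The algorithm passes its feasibility test, generates \<open>T 0, ..., T k\<close>, stops at time \<open>k\<close> and
  returns \<open>x\<close> together with \<open>T k\<close>.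
\<close>

definition greedy_returns ::
  "real ^ 'n ^ 'm \<Rightarrow> real ^ 'm \<Rightarrow> real \<Rightarrow> (nat \<Rightarrow> 'n set) \<Rightarrow> nat \<Rightarrow> ereal ^ 'n \<Rightarrow> bool" where
  "greedy_returns A b \<epsilon> T k x \<longleftrightarrow>
     l1_error A b UNIV \<le> \<epsilon> \<and>
     greedy_sequence A b \<epsilon> T \<and>
     (\<forall>i<k. l1_error A b (T i) > \<epsilon>) \<and> l1_error A b (T k) \<le> \<epsilon> \<and>
     x = greedy_output A b (T k)"

definition Delta :: "real ^ 'n ^ 'm \<Rightarrow> real ^ 'm \<Rightarrow> real" where
  "Delta A b = (MAX (i, j). b $ i - A $ i $ j - principal_solution A b $ j)"

text \<open>Executions exist: the loop never gets stuck for lack of a column to add.\<close>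

lemma greedy_sequence_exists:
  assumes "l1_error A b UNIV \<le> \<epsilon>"
  shows "\<exists>T. greedy_sequence A b \<epsilon> T"
proof -
  have step: "\<exists>S'. l1_error A b S > \<epsilon> \<longrightarrow> greedy_step A b S S'" for S
  proof (cases "l1_error A b S > \<epsilon>")
    case True
    with assms have "- S \<noteq> {}" by (metis Compl_empty_eq double_complement not_less)
    then obtain j where "is_arg_min (\<lambda>s. l1_error A b (S \<union> {s})) (\<lambda>s. s \<in> - S) j"
      using ex_is_arg_min_if_finite[of "- S" "\<lambda>s. l1_error A b (S \<union> {s})"] by auto
    then show ?thesis unfolding greedy_step_def by blast
  qed simp
  then obtain f where f: "\<And>S. l1_error A b S > \<epsilon> \<longrightarrow> greedy_step A b S (f S)" by metis
  have "greedy_sequence A b \<epsilon> (\<lambda>i. (f ^^ i) {})"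
    using f by (simp add: greedy_sequence_def)
  then show ?thesis by blast
qed

end

theory Submission
  imports Defs
begin

text \<open>
  The value \<open>slack A b i j = b\<^sub>i - A\<^sub>i\<^sub>j - x\<^sub>j\<close>, with \<open>x\<close> the principal solution, is the
  nonnegative gap that column \<open>j\<close> leaves in row \<open>i\<close>.  For nonempty \<open>T\<close> the \<open>i\<close>-th error
  component is the least slack over \<open>T\<close>, and the convention for the empty set makes it the greatest
  slack of the row.  So adding a column \<open>j\<close> always replaces the component by its minimum with the
  slack of \<open>j\<close>, with no exception at the empty set (\<open>error_vec_insert\<close>).  Every later property of
  the error function is read off from this recursion.

  The main consequence is a covering inequality (\<open>l1_error_diff_le\<close>): each row error of \<open>S*\<close> is
  attained by one column of \<open>S*\<close>, so the amount by which \<open>S*\<close> beats \<open>S\<close> in that row is gained by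
  adding this single column to \<open>S\<close>.  Hence the gains of the single columns of \<open>S*\<close> sum to at least
  \<open>E(S) - E(S*)\<close>.  The greedy choice is at least as good as each of these columns, so if
  \<open>E(S*) \<le> \<epsilon>\<close> then one step shrinks the excess \<open>E(S) - \<epsilon>\<close> by a factor of at most
  \<open>1 - 1 / |S*|\<close> (\<open>greedy_step_contracts_excess\<close>).  The excess is still positive before the last
  step and is at most \<open>m \<Delta>\<close> at the start, so there are at most
  \<open>1 + |S*| ln (m \<Delta> / (E(T\<^bsub>k-1\<^esub>) - \<epsilon>))\<close> steps.

  Max-plus vectors enter only through their supports.  Any solution of \<open>A \<boxplus> x \<le> b\<close> lies below the
  principal solution, hence its error is at least that of its support (\<open>l1_error_supp_le\<close>); the
  output of the algorithm attains the error of its support (\<open>greedy_output_feasible\<close>).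
\<close>

section \<open>The error function\<close>

definition slack :: "real ^ 'n ^ 'm \<Rightarrow> real ^ 'm \<Rightarrow> 'm \<Rightarrow> 'n \<Rightarrow> real" where
  "slack A b i j = b $ i - A $ i $ j - principal_solution A b $ j"

lemma principal_solution_le: "principal_solution A b $ j \<le> b $ i - A $ i $ j"
  unfolding principal_solution_def by simp

lemma principal_solution_greatest:
  assumes "\<And>i. y \<le> b $ i - A $ i $ j"
  shows "y \<le> principal_solution A b $ j"
  using assms unfolding principal_solution_def by simp

lemma slack_nonneg: "0 \<le> slack A b i j"
  unfolding slack_def using principal_solution_le[of A b j i] by simp

lemma slack_le_Delta: "slack A b i j \<le> Delta A b"
  unfolding Delta_def slack_def by (rule Max_ge) (auto intro!: image_eqI[of _ _ "(i, j)"])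

lemma residual_singleton: "residual A b {j} $ i = slack A b i j"
  by (simp add: residual_def slack_def)

lemma error_vec_empty: "error_vec A b {} $ i = (MAX j. slack A b i j)"
  by (simp add: error_vec_def residual_singleton)

text \<open>
  The value at the empty set is the top element of its row, which is neutral for minima with slacks
  of that row.
\<close>

lemma error_vec_insert:
  "error_vec A b (insert j S) $ i = min (error_vec A b S $ i) (slack A b i j)"
proof (cases "S = {}")
  case True
  have "slack A b i j \<le> (MAX j. slack A b i j)" by simp
  with True show ?thesis
    using error_vec_empty[of A b i]
    by (simp add: error_vec_def[of A b "{j}"] residual_singleton)
next
  case False
  then have "Max ((\<lambda>j. A $ i $ j + principal_solution A b $ j) ` insert j S)
      = max (A $ i $ j + principal_solution A b $ j)
            (MAX j\<in>S. A $ i $ j + principal_solution A b $ j)"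
    by simp
  then have "residual A b (insert j S) $ i = min (residual A b S $ i) (slack A b i j)"
    unfolding residual_def slack_def vec_lambda_beta by linarith
  with False show ?thesis by (simp add: error_vec_def)
qed

lemma error_vec_nonneg: "0 \<le> error_vec A b S $ i"
proof (induction S rule: finite_induct[OF finite])
  case 1
  have "0 \<le> slack A b i undefined" by (rule slack_nonneg)
  also have "\<dots> \<le> (MAX j. slack A b i j)" by simp
  finally show ?case by (simp add: error_vec_empty)
next
  case (2 j S)
  then show ?case by (simp add: error_vec_insert slack_nonneg)
qed

lemma error_vec_attained:
  assumes "S \<noteq> {}"
  obtains j where "j \<in> S" "error_vec A b S $ i = slack A b i j"
proof -
  let ?f = "\<lambda>j. A $ i $ j + principal_solution A b $ j"
  have "Max (?f ` S) \<in> ?f ` S" using assms by (intro Max_in) auto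
  then obtain j where "j \<in> S" "Max (?f ` S) = ?f j" by blast
  with assms show ?thesis
    by (intro that[of j]) (auto simp: error_vec_def residual_def slack_def)
qed

lemma l1_error_eq: "l1_error A b S = (\<Sum>i\<in>UNIV. error_vec A b S $ i)"
  by (simp add: l1_error_def error_vec_nonneg)

lemma l1_error_empty_le:
  fixes A :: "real ^ 'n ^ 'm"
  shows "l1_error A b {} \<le> real CARD('m) * Delta A b"
proof -
  have "error_vec A b {} $ i \<le> Delta A b" for i
    by (simp add: error_vec_empty slack_le_Delta)
  then have "l1_error A b {} \<le> (\<Sum>i\<in>(UNIV :: 'm set). Delta A b)"
    unfolding l1_error_eq by (rule sum_mono)
  then show ?thesis by simp
qed

text \<open>
  Row by row, some single column of \<open>S'\<close> gains all that \<open>S'\<close> gains over \<open>S\<close>, and the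
  other columns cannot increase the error.
\<close>

lemma l1_error_diff_le:
  assumes "S' \<noteq> {}"
  shows "l1_error A b S - l1_error A b S' \<le> (\<Sum>j\<in>S'. l1_error A b S - l1_error A b (insert j S))"
proof -
  let ?gain = "\<lambda>i j. error_vec A b S $ i - error_vec A b (insert j S) $ i"
  have "error_vec A b S $ i - error_vec A b S' $ i \<le> (\<Sum>j\<in>S'. ?gain i j)" for i
  proof -
    obtain j where j: "j \<in> S'" "error_vec A b S' $ i = slack A b i j"
      using error_vec_attained[OF assms] .
    then have "error_vec A b S $ i - error_vec A b S' $ i \<le> ?gain i j"
      by (simp add: error_vec_insert)
    also have "\<dots> \<le> (\<Sum>j\<in>S'. ?gain i j)"
      using j(1) by (intro member_le_sum) (auto simp: error_vec_insert)
    finally show ?thesis .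
  qed
  then have "(\<Sum>i\<in>UNIV. error_vec A b S $ i - error_vec A b S' $ i)
      \<le> (\<Sum>i\<in>UNIV. \<Sum>j\<in>S'. ?gain i j)"
    by (rule sum_mono)
  also have "\<dots> = (\<Sum>j\<in>S'. \<Sum>i\<in>UNIV. ?gain i j)" by (rule sum.swap)
  finally show ?thesis by (simp add: l1_error_eq sum_subtractf)
qed

lemma l1_error_insert_le: "l1_error A b (insert j S) \<le> l1_error A b S"
  unfolding l1_error_eq by (rule sum_mono) (simp add: error_vec_insert)

section \<open>Supports of max-plus solutions\<close>

lemma maxplus_mult_ge: "ereal (A $ i $ j) + x $ j \<le> (A \<boxplus> x) $ i"
  by (simp add: maxplus_mult_def)

lemma maxplus_mult_attained: "\<exists>j. (A \<boxplus> x) $ i = ereal (A $ i $ j) + x $ j"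
proof -
  have "(A \<boxplus> x) $ i \<in> range (\<lambda>j. ereal (A $ i $ j) + x $ j)"
    unfolding maxplus_mult_def vec_lambda_beta by (rule Max_in) auto
  then show ?thesis by blast
qed

lemma l1_norm_nonneg_eq: "(\<And>i. 0 \<le> v $ i) \<Longrightarrow> l1_norm v = (\<Sum>i\<in>UNIV. v $ i)"
  by (simp add: l1_norm_def)

text \<open>
  In each row, either the maximum defining \<open>A \<boxplus> x\<close> is \<open>-\<infinity>\<close> or it is attained at a column of
  the support, where \<open>x\<close> lies below the principal solution.
\<close>

lemma error_vec_supp_le:
  assumes "x \<in> feasible_set A b \<epsilon>"
  shows "ereal (error_vec A b (supp x) $ i) \<le> (ereal_vec b - A \<boxplus> x) $ i"
proof -
  obtain j where j: "(A \<boxplus> x) $ i = ereal (A $ i $ j) + x $ j"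
    using maxplus_mult_attained by blast
  have below: "ereal (A $ i' $ j) + x $ j \<le> ereal (b $ i')" for i'
    using assms maxplus_mult_ge[of A i' j x] order_trans
    by (fastforce simp: feasible_set_def less_eq_vec_def ereal_vec_def)
  have "x $ j \<noteq> \<infinity>" using assms by (simp add: feasible_set_def Rmax_vectors_def)
  then show ?thesis
  proof (cases "x $ j")
    case (real y)
    with below have "y \<le> principal_solution A b $ j"
      by (intro principal_solution_greatest) (simp add: le_diff_eq add.commute)
    moreover have "error_vec A b (supp x) $ i \<le> slack A b i j"
      using real error_vec_insert[of A b j "supp x" i] by (simp add: supp_def insert_absorb)
    ultimately show ?thesis
      using real j by (simp add: slack_def ereal_vec_def)
  qed (use j in \<open>simp_all add: ereal_vec_def\<close>)
qed

lemma l1_error_supp_le: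
  assumes "x \<in> feasible_set A b \<epsilon>"
  shows "l1_error A b (supp x) \<le> \<epsilon>"
proof -
  note le = error_vec_supp_le[OF assms]
  have nonneg: "0 \<le> (ereal_vec b - A \<boxplus> x) $ i" for i
    using le[of i] error_vec_nonneg[of A b "supp x" i] order_trans
    by (metis ereal_less_eq(5))
  have "ereal (l1_error A b (supp x)) = (\<Sum>i\<in>UNIV. ereal (error_vec A b (supp x) $ i))"
    by (simp add: l1_error_eq)
  also have "\<dots> \<le> (\<Sum>i\<in>UNIV. (ereal_vec b - A \<boxplus> x) $ i)" by (rule sum_mono) (rule le)
  also have "\<dots> = l1_norm (ereal_vec b - A \<boxplus> x)" using nonneg by (simp add: l1_norm_nonneg_eq)
  also have "\<dots> \<le> ereal \<epsilon>" using assms by (simp add: feasible_set_def)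
  finally show ?thesis by simp
qed

lemma supp_greedy_output: "supp (greedy_output A b S) = S"
  by (auto simp: supp_def greedy_output_def)

lemma maxplus_mult_greedy_output:
  assumes "S \<noteq> {}"
  shows "(A \<boxplus> greedy_output A b S) $ i = ereal (b $ i - error_vec A b S $ i)"
proof -
  let ?x = "greedy_output A b S"
  obtain j where j: "j \<in> S" "error_vec A b S $ i = slack A b i j"
    using error_vec_attained[OF assms] .
  have "(A \<boxplus> ?x) $ i \<le> ereal (b $ i - error_vec A b S $ i)"
  proof -
    obtain l where l: "(A \<boxplus> ?x) $ i = ereal (A $ i $ l) + ?x $ l"
      using maxplus_mult_attained by blast
    show ?thesis
    proof (cases "l \<in> S")
      case True
      then have "error_vec A b S $ i \<le> slack A b i l"
        using error_vec_insert[of A b l S i] by (simp add: insert_absorb)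
      with l True show ?thesis by (simp add: greedy_output_def slack_def)
    next
      case False
      then have "?x $ l = -\<infinity>" by (simp add: greedy_output_def)
      with l show ?thesis by simp
    qed
  qed
  moreover have "ereal (b $ i - error_vec A b S $ i) \<le> (A \<boxplus> ?x) $ i"
    using j maxplus_mult_ge[of A i j ?x] by (simp add: greedy_output_def slack_def)
  ultimately show ?thesis by (rule order_antisym)
qed

lemma greedy_output_feasible:
  assumes "S \<noteq> {}" "l1_error A b S \<le> \<epsilon>"
  shows "greedy_output A b S \<in> feasible_set A b \<epsilon>"
proof -
  let ?x = "greedy_output A b S"
  have "(ereal_vec b - A \<boxplus> ?x) $ i = ereal (error_vec A b S $ i)" for i
    by (simp add: maxplus_mult_greedy_output[OF assms(1)] ereal_vec_def)
  then have "l1_norm (ereal_vec b - A \<boxplus> ?x) = ereal (l1_error A b S)"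
    by (simp add: l1_norm_def l1_error_eq error_vec_nonneg)
  moreover have "A \<boxplus> ?x \<le> ereal_vec b"
    by (simp add: less_eq_vec_def ereal_vec_def maxplus_mult_greedy_output[OF assms(1)]
        error_vec_nonneg)
  moreover have "?x \<in> Rmax_vectors" by (simp add: Rmax_vectors_def greedy_output_def)
  ultimately show ?thesis using assms(2) by (simp add: feasible_set_def)
qed

section \<open>Greedy steps\<close>

text \<open>
  The greedy gain is at least the average of the gains of the columns of \<open>S'\<close>; a column already
  in \<open>S\<close> gains nothing.
\<close>

lemma greedy_step_contracts_excess:
  assumes step: "greedy_step A b S S1" and S': "S' \<noteq> {}" "l1_error A b S' \<le> \<epsilon>"
  shows "l1_error A b S1 - \<epsilon> \<le> (1 - 1 / real (card S')) * (l1_error A b S - \<epsilon>)"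
proof -
  obtain s where s: "is_arg_min (\<lambda>s. l1_error A b (S \<union> {s})) (\<lambda>s. s \<in> - S) s"
    and S1: "S1 = insert s S"
    using step by (auto simp: greedy_step_def)
  have best: "l1_error A b S1 \<le> l1_error A b (insert j S)" for j
  proof (cases "j \<in> S")
    case True
    then show ?thesis by (simp add: S1 insert_absorb l1_error_insert_le)
  next
    case False
    with s show ?thesis by (auto simp: is_arg_min_linorder S1)
  qed
  have "l1_error A b S - \<epsilon> \<le> (\<Sum>j\<in>S'. l1_error A b S - l1_error A b (insert j S))"
    using l1_error_diff_le[OF S'(1), of A b S] S'(2) by linarith
  also have "\<dots> \<le> (\<Sum>j\<in>S'. l1_error A b S - l1_error A b S1)"
    by (rule sum_mono) (simp add: best)
  also have "\<dots> = real (card S') * (l1_error A b S - l1_error A b S1)" by simp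
  finally have "l1_error A b S - \<epsilon> \<le> real (card S') * (l1_error A b S - l1_error A b S1)" .
  moreover have "0 < real (card S')" using S'(1) by (simp add: card_gt_0_iff)
  ultimately have "(l1_error A b S - \<epsilon>) / real (card S') \<le> l1_error A b S - l1_error A b S1"
    by (simp add: pos_divide_le_eq mult.commute)
  then show ?thesis by (simp add: left_diff_distrib)
qed

lemma card_greedy_step: "greedy_step A b S S1 \<Longrightarrow> card S1 = Suc (card S)"
  by (auto simp: greedy_step_def is_arg_min_def)

lemma greedy_sequence_card:
  assumes "greedy_sequence A b \<epsilon> T" "\<And>i. i < k \<Longrightarrow> l1_error A b (T i) > \<epsilon>"
  shows "card (T k) = k"
  using assms(2)
proof (induction k)
  case 0
  with assms(1) show ?case by (simp add: greedy_sequence_def)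
next
  case (Suc k)
  then have "greedy_step A b (T k) (T (Suc k))"
    using assms(1) by (simp add: greedy_sequence_def)
  with Suc show ?case by (simp add: card_greedy_step)
qed

text \<open>Otherwise \<open>T\<close> would gain a new column at every step, but there are finitely many columns.\<close>

lemma greedy_sequence_terminates:
  fixes A :: "real ^ 'n ^ 'm"
  assumes "greedy_sequence A b \<epsilon> T"
  obtains k where "l1_error A b (T k) \<le> \<epsilon>" "\<And>i. i < k \<Longrightarrow> l1_error A b (T i) > \<epsilon>"
proof -
  have "\<exists>k. l1_error A b (T k) \<le> \<epsilon>"
  proof (rule ccontr)
    assume "\<nexists>k. l1_error A b (T k) \<le> \<epsilon>"
    then have "card (T (Suc CARD('n))) = Suc CARD('n)"
      using assms by (intro greedy_sequence_card) (auto simp: not_le)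
    moreover have "card (T (Suc CARD('n))) \<le> CARD('n)" by (rule card_mono) auto
    ultimately show False by simp
  qed
  then show ?thesis
    using that exists_least_iff[of "\<lambda>k. l1_error A b (T k) \<le> \<epsilon>"] by (auto simp: not_le)
qed

text \<open>
  Iterated contraction, combined with \<open>1 - 1 / t \<le> exp (- 1 / t)\<close>.
\<close>

lemma contraction_steps_le_ln:
  fixes g :: "nat \<Rightarrow> real"
  assumes t: "1 \<le> t" and pos: "\<And>i. i \<le> n \<Longrightarrow> 0 < g i"
    and step: "\<And>i. i < n \<Longrightarrow> g (Suc i) \<le> (1 - 1 / t) * g i"
  shows "real n / t \<le> ln (g 0 / g n)"
proof -
  have "i \<le> n \<Longrightarrow> real i / t \<le> ln (g 0) - ln (g i)" for i
  proof (induction i)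
    case (Suc i)
    have gi: "0 < g i" and gS: "0 < g (Suc i)" using Suc.prems pos by simp_all
    have "g (Suc i) \<le> (1 - 1 / t) * g i" using Suc.prems step by simp
    also have "\<dots> \<le> exp (- (1 / t)) * g i"
      using gi exp_ge_add_one_self[of "- (1 / t)"] by (intro mult_right_mono) auto
    finally have "ln (g (Suc i)) \<le> ln (exp (- (1 / t)) * g i)"
      using gi gS by (subst ln_le_cancel_iff) auto
    also have "\<dots> = ln (g i) - 1 / t" using gi by (simp add: ln_mult)
    finally show ?case using Suc by (simp add: add_divide_distrib)
  qed simp
  from this[of n] show ?thesis using pos[of 0] pos[of n] by (simp add: ln_div)
qed

section \<open>The approximation guarantee\<close>

theorem theorem4:
  fixes A :: "real ^ 'n ^ 'm" and b :: "real ^ 'm" and \<epsilon> :: real and T :: "nat \<Rightarrow> 'n set"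
  assumes "\<epsilon> \<ge> 0"
    and "l1_error A b UNIV \<le> \<epsilon>"
    and "l1_error A b {} > \<epsilon>"
    and "greedy_sequence A b \<epsilon> T"
  shows "(\<exists>k xhat. greedy_returns A b \<epsilon> T k xhat) \<and>
    (\<forall>k xhat. greedy_returns A b \<epsilon> T k xhat \<longrightarrow>
      xhat \<in> feasible_set A b \<epsilon> \<and> T k = supp xhat \<and>
      (\<forall>xstar Tstar. optimal_solution A b \<epsilon> xstar \<longrightarrow> Tstar = supp xstar \<longrightarrow>
        real (card (T k)) / real (card Tstar)
          \<le> 1 + ln (real CARD('m) * Delta A b / (l1_error A b (T (k - 1)) - \<epsilon>))))"
proof (intro conjI allI impI)
  obtain k where "l1_error A b (T k) \<le> \<epsilon>" "\<And>i. i < k \<Longrightarrow> l1_error A b (T i) > \<epsilon>"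
    using greedy_sequence_terminates[OF assms(4)] by blast
  then show "\<exists>k xhat. greedy_returns A b \<epsilon> T k xhat"
    using assms by (auto simp: greedy_returns_def)
next
  fix k xhat
  assume ret: "greedy_returns A b \<epsilon> T k xhat"
  then have xhat: "xhat = greedy_output A b (T k)"
    and stop: "l1_error A b (T k) \<le> \<epsilon>"
    and running: "\<And>i. i < k \<Longrightarrow> l1_error A b (T i) > \<epsilon>"
    by (auto simp: greedy_returns_def)
  have T0: "T 0 = {}" using assms(4) by (simp add: greedy_sequence_def)
  show "T k = supp xhat" by (simp add: xhat supp_greedy_output)
  have "T k \<noteq> {}" using stop assms(3) by auto
  then show "xhat \<in> feasible_set A b \<epsilon>"
    unfolding xhat using stop by (rule greedy_output_feasible)
  fix xstar Tstar
  assume "optimal_solution A b \<epsilon> xstar" and Tstar: "Tstar = supp xstar"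
  then have err: "l1_error A b Tstar \<le> \<epsilon>"
    by (simp add: optimal_solution_def l1_error_supp_le)
  with assms(3) have ne: "Tstar \<noteq> {}" by auto
  define t where "t = real (card Tstar)"
  have t: "1 \<le> t" using ne by (simp add: t_def Suc_le_eq card_gt_0_iff)
  have "0 < k" using stop assms(3) T0 by (cases "k = 0") auto
  then obtain n where k: "k = Suc n" using gr0_implies_Suc by blast
  let ?g = "\<lambda>i. l1_error A b (T i) - \<epsilon>"
  have "?g (Suc i) \<le> (1 - 1 / t) * ?g i" if "i < n" for i
  proof -
    have "greedy_step A b (T i) (T (Suc i))"
      using assms(4) running that k by (simp add: greedy_sequence_def)
    then show ?thesis unfolding t_def using ne err by (rule greedy_step_contracts_excess)
  qed
  then have "real n / t \<le> ln (?g 0 / ?g n)"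
    using t running k by (intro contraction_steps_le_ln) auto
  also have "\<dots> \<le> ln (real CARD('m) * Delta A b / ?g n)"
  proof -
    have pos: "0 < ?g 0" "0 < ?g n" using running k by simp_all
    have "?g 0 \<le> real CARD('m) * Delta A b"
      using l1_error_empty_le[of A b] assms(1) T0 by simp
    with pos show ?thesis
      by (subst ln_le_cancel_iff) (auto intro!: divide_right_mono divide_pos_pos)
  qed
  finally have "real n / t \<le> ln (real CARD('m) * Delta A b / ?g n)" .
  moreover have "real (card (T k)) / t \<le> 1 + real n / t"
    using greedy_sequence_card[OF assms(4) running] t k by (simp add: field_simps)
  ultimately show "real (card (T k)) / real (card Tstar)
      \<le> 1 + ln (real CARD('m) * Delta A b / (l1_error A b (T (k - 1)) - \<epsilon>))"
    by (simp add: t_def k)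
qed

end
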